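(* Let $X=\varinjlim X_i$ be a colimit of weak higher dimensional transition systems such that every $X_i$ satisfies the Unique intermediate state axiom. Let $X_i=(S_i,\mu_i:L_i\to\Sigma,T^i=\bigcup_{n\ge1}T^i_n)$ and $X=(S,\mu:L\to\Sigma,T=\bigcup_{n\ge1}T_n)$. Denote by $\bigcup_iT^i\subset\bigcup_{n\ge1}(S\times L^n\times S)$ the union of the images by the maps $X_i\to X$ of the sets of transitions of the $X_i$, for $i$ running over the set of objects of the base category of the diagram $i\mapsto X_i$. Then the following conditions are equivalent: 1. the weak higher dimensional transition system $X$ satisfies the Unique intermediate state axiom; 2. the set of transitions $\bigcup_iT^i$ satisfies the Unique intermediate state axiom; 3. the set of transitions $\bigcup_iT^i$ satisfies the Multiset axiom, the Coherence axiom and the Unique intermediate state axiom. Whenever one of these three conditions is satisfied, the set of transitions $\bigcup_iT^i$ is the final structure, i.e. $T=\bigcup_iT^i$.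
   Context: $\Sigma$ is a fixed nonempty set of labels. A weak higher dimensional transition system is a triple $(S,\mu:L\to\Sigma,T=\bigcup_{n\ge1}T_n)$ with $S$ a set (states), $L$ a set (actions), $\mu$ a set map (labelling map) and $T_n\subset S\times L^n\times S$ ($n$-transitions) such that: - (Multiset axiom) for every permutation $\sigma$ of $\{1,\dots,n\}$, $n\ge2$, if $(\alpha,u_1,\dots,u_n,\beta)\in T$ then $(\alpha,u_{\sigma(1)},\dots,u_{\sigma(n)},\beta)\in T$; - (Coherence axiom) for $n\ge3$, $p,q\ge1$ with $p+q<n$, if $(\alpha,u_1,\dots,u_n,\beta)$, $(\alpha,u_1,\dots,u_p,\nu_1)$, $(\nu_1,u_{p+1},\dots,u_n,\beta)$, $(\alpha,u_1,\dots,u_{p+q},\nu_2)$, $(\nu_2,u_{p+q+1},\dots,u_n,\beta)$ are transitions, then $(\nu_1,u_{p+1},\dots,u_{p+q},\nu_2)$ is a transition. A morphism $f$ consists of a map $f_0$ on states and a map $\widetilde f$ on actions commuting with the labelling maps, such that $(f_0(\alpha),\widetilde f(u_1),\dots,\widetilde f(u_n),f_0(\beta))$ is a transition whenever $(\alpha,u_1,\dots,u_n,\beta)$ is. The category is $\mathbf{WHDTS}$; colimits (over small diagrams) are taken in it. In a colimit one has $S=\varinjlim S_i$, $L=\varinjlim L_i$, $\mu=\varinjlim\mu_i$, and $T$ is the final structure: the smallest set of transitions on $(S,\mu)$ satisfying the Multiset and Coherence axioms and making all maps $X_i\to X$ morphisms. Unique intermediate state axiom (for a set of transitions): for every $n\ge2$,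 every $p$ with $1\le p<n$ and every transition $(\alpha,u_1,\dots,u_n,\beta)$ in the set, there exists a unique state $\nu$ such that both $(\alpha,u_1,\dots,u_p,\nu)$ and $(\nu,u_{p+1},\dots,u_n,\beta)$ are transitions in the set. *)

theory Defs
  imports "HOL-Library.FuncSet" "HOL-Combinatorics.Permutations"
begin

section \<open>Weak higher dimensional transition systems\<close>

text \<open>
  The fixed nonempty set of labels is the type \<open>'a\<close>. States and actions form arbitrary, possibly
  empty, carrier sets. The transition \<open>(\<alpha>, u\<^sub>1, \<dots>, u\<^sub>n, \<beta>)\<close> is encoded as
  \<open>(\<alpha>, [u\<^sub>1, \<dots>, u\<^sub>n], \<beta>)\<close>; lists are indexed from 0.
\<close>

record ('s, 'l, 'a) wts =
  States :: "'s set"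
  Actions :: "'l set"
  Label :: "'l \<Rightarrow> 'a"
  Trans :: "('s \<times> 'l list \<times> 's) set"

definition transitions_on :: "'s set \<Rightarrow> 'l set \<Rightarrow> ('s \<times> 'l list \<times> 's) set" where
  "transitions_on S L = {(\<alpha>, us, \<beta>). \<alpha> \<in> S \<and> us \<noteq> [] \<and> set us \<subseteq> L \<and> \<beta> \<in> S}"

definition multiset_axiom :: "('s \<times> 'l list \<times> 's) set \<Rightarrow> bool" where
  "multiset_axiom T \<longleftrightarrow>
    (\<forall>\<alpha> us \<beta> \<sigma>. length us \<ge> 2 \<longrightarrow> \<sigma> permutes {..<length us} \<longrightarrow>
       (\<alpha>, us, \<beta>) \<in> T \<longrightarrow> (\<alpha>, permute_list \<sigma> us, \<beta>) \<in> T)"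

definition coherence_axiom :: "('s \<times> 'l list \<times> 's) set \<Rightarrow> bool" where
  "coherence_axiom T \<longleftrightarrow>
    (\<forall>\<alpha> us \<beta> \<nu>\<^sub>1 \<nu>\<^sub>2 p q. length us \<ge> 3 \<longrightarrow> p \<ge> 1 \<longrightarrow> q \<ge> 1 \<longrightarrow> p + q < length us \<longrightarrow>
       (\<alpha>, us, \<beta>) \<in> T \<longrightarrow>
       (\<alpha>, take p us, \<nu>\<^sub>1) \<in> T \<longrightarrow> (\<nu>\<^sub>1, drop p us, \<beta>) \<in> T \<longrightarrow>
       (\<alpha>, take (p + q) us, \<nu>\<^sub>2) \<in> T \<longrightarrow> (\<nu>\<^sub>2, drop (p + q) us, \<beta>) \<in> T \<longrightarrow>
       (\<nu>\<^sub>1, take q (drop p us), \<nu>\<^sub>2) \<in> T)"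

definition unique_intermediate_state :: "('s \<times> 'l list \<times> 's) set \<Rightarrow> bool" where
  "unique_intermediate_state T \<longleftrightarrow>
    (\<forall>\<alpha> us \<beta> p. length us \<ge> 2 \<longrightarrow> 1 \<le> p \<longrightarrow> p < length us \<longrightarrow> (\<alpha>, us, \<beta>) \<in> T \<longrightarrow>
       (\<exists>!\<nu>. (\<alpha>, take p us, \<nu>) \<in> T \<and> (\<nu>, drop p us, \<beta>) \<in> T))"

definition whdts :: "('s, 'l, 'a) wts \<Rightarrow> bool" where
  "whdts X \<longleftrightarrow> Trans X \<subseteq> transitions_on (States X) (Actions X) \<and>
     multiset_axiom (Trans X) \<and> coherence_axiom (Trans X)"

section \<open>Morphisms\<close>

type_synonym ('s, 'l, 't, 'm) mor = "('s \<Rightarrow> 't) \<times> ('l \<Rightarrow> 'm)"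

definition map_transition ::
    "('s, 'l, 't, 'm) mor \<Rightarrow> 's \<times> 'l list \<times> 's \<Rightarrow> 't \<times> 'm list \<times> 't" where
  "map_transition f = (\<lambda>(\<alpha>, us, \<beta>). (fst f \<alpha>, map (snd f) us, fst f \<beta>))"

text \<open>
  Both components are extensional (equal to \<open>undefined\<close> off the carriers), so that equality in
  HOL is equality of morphisms.
\<close>

definition hom :: "('s, 'l, 'a) wts \<Rightarrow> ('t, 'm, 'a) wts \<Rightarrow> ('s, 'l, 't, 'm) mor set" where
  "hom X Y = {f. fst f \<in> States X \<rightarrow>\<^sub>E States Y \<and> snd f \<in> Actions X \<rightarrow>\<^sub>E Actions Y \<and>
     (\<forall>u \<in> Actions X. Label Y (snd f u) = Label X u) \<and>
     map_transition f ` Trans X \<subseteq> Trans Y}"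

definition id_mor :: "('s, 'l, 'a) wts \<Rightarrow> ('s, 'l, 's, 'l) mor" where
  "id_mor X = (\<lambda>s \<in> States X. s, \<lambda>u \<in> Actions X. u)"

text \<open>\<open>comp_mor X g f\<close> is \<open>g \<circ> f\<close> for a morphism \<open>f\<close> with source \<open>X\<close>.\<close>

definition comp_mor ::
    "('s, 'l, 'a) wts \<Rightarrow> ('t, 'm, 'u, 'v) mor \<Rightarrow> ('s, 'l, 't, 'm) mor \<Rightarrow> ('s, 'l, 'u, 'v) mor" where
  "comp_mor X g f = (compose (States X) (fst g) (fst f), compose (Actions X) (snd g) (snd f))"

section \<open>Small diagrams and their colimits\<close>

record ('i, 'e) category =
  Ob :: "'i set"
  Ar :: "'e set"
  src :: "'e \<Rightarrow> 'i"
  tgt :: "'e \<Rightarrow> 'i"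
  ide :: "'i \<Rightarrow> 'e"
  cmp :: "'e \<Rightarrow> 'e \<Rightarrow> 'e"

definition small_category :: "('i, 'e) category \<Rightarrow> bool" where
  "small_category C \<longleftrightarrow>
     (\<forall>e \<in> Ar C. src C e \<in> Ob C \<and> tgt C e \<in> Ob C) \<and>
     (\<forall>i \<in> Ob C. ide C i \<in> Ar C \<and> src C (ide C i) = i \<and> tgt C (ide C i) = i) \<and>
     (\<forall>e \<in> Ar C. \<forall>f \<in> Ar C. src C f = tgt C e \<longrightarrow>
        cmp C f e \<in> Ar C \<and> src C (cmp C f e) = src C e \<and> tgt C (cmp C f e) = tgt C f) \<and>
     (\<forall>e \<in> Ar C. cmp C e (ide C (src C e)) = e \<and> cmp C (ide C (tgt C e)) e = e) \<and>
     (\<forall>e \<in> Ar C. \<forall>f \<in> Ar C. \<forall>g \<in> Ar C. src C f = tgt C e \<longrightarrow> src C g = tgt C f \<longrightarrow>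
        cmp C g (cmp C f e) = cmp C (cmp C g f) e)"

text \<open>A functor \<open>C \<rightarrow> WHDTS\<close>, given by \<open>F\<close> on objects and \<open>M\<close> on arrows.\<close>

definition diagram ::
    "('i, 'e) category \<Rightarrow> ('i \<Rightarrow> ('s, 'l, 'a) wts) \<Rightarrow> ('e \<Rightarrow> ('s, 'l, 's, 'l) mor) \<Rightarrow> bool" where
  "diagram C F M \<longleftrightarrow> small_category C \<and>
     (\<forall>i \<in> Ob C. whdts (F i)) \<and>
     (\<forall>e \<in> Ar C. M e \<in> hom (F (src C e)) (F (tgt C e))) \<and>
     (\<forall>i \<in> Ob C. M (ide C i) = id_mor (F i)) \<and>
     (\<forall>e \<in> Ar C. \<forall>f \<in> Ar C. src C f = tgt C e \<longrightarrow>
        M (cmp C f e) = comp_mor (F (src C e)) (M f) (M e))"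

definition cocone ::
    "('i, 'e) category \<Rightarrow> ('i \<Rightarrow> ('s, 'l, 'a) wts) \<Rightarrow> ('e \<Rightarrow> ('s, 'l, 's, 'l) mor) \<Rightarrow>
     ('t, 'm, 'a) wts \<Rightarrow> ('i \<Rightarrow> ('s, 'l, 't, 'm) mor) \<Rightarrow> bool" where
  "cocone C F M Y \<kappa> \<longleftrightarrow> whdts Y \<and> (\<forall>i \<in> Ob C. \<kappa> i \<in> hom (F i) Y) \<and>
     (\<forall>e \<in> Ar C. comp_mor (F (src C e)) (\<kappa> (tgt C e)) (M e) = \<kappa> (src C e))"

text \<open>The universal property, tested on the objects carried by the types \<open>'u\<close> and \<open>'v\<close>.\<close>

definition universal_wrt ::
    "'u itself \<Rightarrow> 'v itself \<Rightarrow>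
     ('i, 'e) category \<Rightarrow> ('i \<Rightarrow> ('s, 'l, 'a) wts) \<Rightarrow> ('e \<Rightarrow> ('s, 'l, 's, 'l) mor) \<Rightarrow>
     ('t, 'm, 'a) wts \<Rightarrow> ('i \<Rightarrow> ('s, 'l, 't, 'm) mor) \<Rightarrow> bool" where
  "universal_wrt _ _ C F M X \<iota> \<longleftrightarrow>
     (\<forall>(Y :: ('u, 'v, 'a) wts) \<kappa>. cocone C F M Y \<kappa> \<longrightarrow>
        (\<exists>!g. g \<in> hom X Y \<and> (\<forall>i \<in> Ob C. comp_mor (F i) g (\<iota> i) = \<kappa> i)))"

text \<open>
  HOL cannot quantify over types inside a formula, so the test objects of a colimit carried by
  \<open>'t\<close> and \<open>'m\<close> range over the types \<open>'t \<times> bool\<close> and \<open>'m \<times> bool\<close>. This loses nothing: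
  by \<open>colimit_universal\<close> below, the universal property then holds for test objects carried by
  arbitrary types.
\<close>

definition is_colimit ::
    "('i, 'e) category \<Rightarrow> ('i \<Rightarrow> ('s, 'l, 'a) wts) \<Rightarrow> ('e \<Rightarrow> ('s, 'l, 's, 'l) mor) \<Rightarrow>
     ('t, 'm, 'a) wts \<Rightarrow> ('i \<Rightarrow> ('s, 'l, 't, 'm) mor) \<Rightarrow> bool" where
  "is_colimit C F M X \<iota> \<longleftrightarrow> cocone C F M X \<iota> \<and>
     universal_wrt TYPE('t \<times> bool) TYPE('m \<times> bool) C F M X \<iota>"

text \<open>The union of the images of the sets of transitions of the \<open>F i\<close>.\<close>

definition union_trans ::
    "('i, 'e) category \<Rightarrow> ('i \<Rightarrow> ('s, 'l, 'a) wts) \<Rightarrow> ('i \<Rightarrow> ('s, 'l, 't, 'm) mor) \<Rightarrow>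
     ('t \<times> 'm list \<times> 't) set" where
  "union_trans C F \<iota> = (\<Union>i \<in> Ob C. map_transition (\<iota> i) ` Trans (F i))"

text \<open>
  \<open>T\<close> is the smallest set of transitions on the states and actions of \<open>X\<close> satisfying the Multiset
  and Coherence axioms and making every \<open>\<iota> i\<close> a morphism; the field \<open>Trans X\<close> is overwritten.
\<close>

definition makes_morphisms ::
    "('i, 'e) category \<Rightarrow> ('i \<Rightarrow> ('s, 'l, 'a) wts) \<Rightarrow> ('t, 'm, 'a) wts \<Rightarrow>
     ('i \<Rightarrow> ('s, 'l, 't, 'm) mor) \<Rightarrow> ('t \<times> 'm list \<times> 't) set \<Rightarrow> bool" where
  "makes_morphisms C F X \<iota> T \<longleftrightarrow>
     whdts (X\<lparr>Trans := T\<rparr>) \<and> (\<forall>i \<in> Ob C. \<iota> i \<in> hom (F i) (X\<lparr>Trans := T\<rparr>))"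

definition is_final_structure ::
    "('i, 'e) category \<Rightarrow> ('i \<Rightarrow> ('s, 'l, 'a) wts) \<Rightarrow> ('t, 'm, 'a) wts \<Rightarrow>
     ('i \<Rightarrow> ('s, 'l, 't, 'm) mor) \<Rightarrow> ('t \<times> 'm list \<times> 't) set \<Rightarrow> bool" where
  "is_final_structure C F X \<iota> T \<longleftrightarrow> makes_morphisms C F X \<iota> T \<and>
     (\<forall>T'. makes_morphisms C F X \<iota> T' \<longrightarrow> T \<subseteq> T')"

section \<open>The universal property of a colimit holds for all types of test objects\<close>

lemma comp_mor_eq_iff:
  assumes "k \<in> hom X Z"
  shows "comp_mor X g f = k \<longleftrightarrow>
    (\<forall>s \<in> States X. fst g (fst f s) = fst k s) \<and> (\<forall>u \<in> Actions X. snd g (snd f u) = snd k u)"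
proof -
  have k: "fst k \<in> extensional (States X)" "snd k \<in> extensional (Actions X)"
    using assms by (auto simp: hom_def PiE_def)
  have "compose (States X) (fst g) (fst f) = fst k \<longleftrightarrow> (\<forall>s \<in> States X. fst g (fst f s) = fst k s)"
    using k(1) by (auto simp: compose_def extensional_def fun_eq_iff)
  moreover have "compose (Actions X) (snd g) (snd f) = snd k \<longleftrightarrow>
      (\<forall>u \<in> Actions X. snd g (snd f u) = snd k u)"
    using k(2) by (auto simp: compose_def extensional_def fun_eq_iff)
  ultimately show ?thesis
    by (cases k) (simp add: comp_mor_def)
qed

definition pullback ::
    "'u set \<Rightarrow> 'v set \<Rightarrow> ('u, 'v, 't, 'm) mor \<Rightarrow> ('t \<times> 'm list \<times> 't) set \<Rightarrow>
     ('u \<times> 'v list \<times> 'u) set" where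
  "pullback S L f T = {t \<in> transitions_on S L. map_transition f t \<in> T}"

lemma pullback_axioms:
  assumes "multiset_axiom T" "coherence_axiom T"
  shows "multiset_axiom (pullback S L f T)" "coherence_axiom (pullback S L f T)"
proof -
  show "multiset_axiom (pullback S L f T)"
    unfolding multiset_axiom_def
  proof (intro allI impI)
    fix \<alpha> us \<beta> \<sigma>
    assume len: "2 \<le> length us" and perm: "\<sigma> permutes {..<length us}"
      and t: "(\<alpha>, us, \<beta>) \<in> pullback S L f T"
    have "(fst f \<alpha>, permute_list \<sigma> (map (snd f) us), fst f \<beta>) \<in> T"
      using assms(1) len perm t
      by (auto simp: multiset_axiom_def pullback_def map_transition_def)
    then show "(\<alpha>, permute_list \<sigma> us, \<beta>) \<in> pullback S L f T"
      using len perm t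
      by (auto simp: pullback_def map_transition_def transitions_on_def permute_list_map
          simp flip: length_greater_0_conv)
  qed
  show "coherence_axiom (pullback S L f T)"
    unfolding coherence_axiom_def
  proof (intro allI impI)
    fix \<alpha> us \<beta> \<nu>\<^sub>1 \<nu>\<^sub>2 p q
    assume len: "3 \<le> length us" "1 \<le> p" "1 \<le> q" "p + q < length us"
      and t: "(\<alpha>, us, \<beta>) \<in> pullback S L f T"
      "(\<alpha>, take p us, \<nu>\<^sub>1) \<in> pullback S L f T" "(\<nu>\<^sub>1, drop p us, \<beta>) \<in> pullback S L f T"
      "(\<alpha>, take (p + q) us, \<nu>\<^sub>2) \<in> pullback S L f T" "(\<nu>\<^sub>2, drop (p + q) us, \<beta>) \<in> pullback S L f T"
    let ?us = "map (snd f) us"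
    have "(fst f \<alpha>, ?us, fst f \<beta>) \<in> T"
      "(fst f \<alpha>, take p ?us, fst f \<nu>\<^sub>1) \<in> T" "(fst f \<nu>\<^sub>1, drop p ?us, fst f \<beta>) \<in> T"
      "(fst f \<alpha>, take (p + q) ?us, fst f \<nu>\<^sub>2) \<in> T" "(fst f \<nu>\<^sub>2, drop (p + q) ?us, fst f \<beta>) \<in> T"
      using t by (auto simp: pullback_def map_transition_def take_map drop_map)
    then have "(fst f \<nu>\<^sub>1, take q (drop p ?us), fst f \<nu>\<^sub>2) \<in> T"
      using assms(2)[unfolded coherence_axiom_def, rule_format,
          of ?us p q "fst f \<alpha>" "fst f \<beta>" "fst f \<nu>\<^sub>1" "fst f \<nu>\<^sub>2"] len by simp
    moreover have "set (take q (drop p us)) \<subseteq> L"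
      using t(1) set_take_subset[of q "drop p us"] set_drop_subset[of p us]
      by (auto simp: pullback_def transitions_on_def)
    ultimately show "(\<nu>\<^sub>1, take q (drop p us), \<nu>\<^sub>2) \<in> pullback S L f T"
      using t len by (auto simp: pullback_def map_transition_def transitions_on_def take_map drop_map)
  qed
qed

lemma colimit_lift:
  fixes X :: "('t, 'm, 'a) wts" and P :: "'i \<Rightarrow> 's \<Rightarrow> bool" and Q :: "'i \<Rightarrow> 'l \<Rightarrow> bool"
  assumes dia: "diagram C F M" and col: "is_colimit C F M X \<iota>"
    and T: "makes_morphisms C F X \<iota> T"
    and P: "\<And>e s. e \<in> Ar C \<Longrightarrow> s \<in> States (F (src C e)) \<Longrightarrow>
      P (tgt C e) (fst (M e) s) = P (src C e) s"
    and Q: "\<And>e u. e \<in> Ar C \<Longrightarrow> u \<in> Actions (F (src C e)) \<Longrightarrow>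
      Q (tgt C e) (snd (M e) u) = Q (src C e) u"
  shows "\<exists>!g. g \<in> hom X \<lparr>States = States X \<times> UNIV, Actions = Actions X \<times> UNIV,
        Label = Label X \<circ> fst,
        Trans = pullback (States X \<times> UNIV) (Actions X \<times> UNIV) (fst, fst) T\<rparr> \<and>
      (\<forall>i \<in> Ob C. (\<forall>s \<in> States (F i). fst g (fst (\<iota> i) s) = (fst (\<iota> i) s, P i s)) \<and>
        (\<forall>u \<in> Actions (F i). snd g (snd (\<iota> i) u) = (snd (\<iota> i) u, Q i u)))"
proof -
  define Y :: "('t \<times> bool, 'm \<times> bool, 'a) wts" where
    "Y = \<lparr>States = States X \<times> UNIV, Actions = Actions X \<times> UNIV, Label = Label X \<circ> fst,
      Trans = pullback (States X \<times> UNIV) (Actions X \<times> UNIV) (fst, fst) T\<rparr>"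
  define \<kappa> where "\<kappa> i = (\<lambda>s \<in> States (F i). (fst (\<iota> i) s, P i s),
      \<lambda>u \<in> Actions (F i). (snd (\<iota> i) u, Q i u))" for i
  have cat: "src C e \<in> Ob C" "tgt C e \<in> Ob C" if "e \<in> Ar C" for e
    using dia that by (auto simp: diagram_def small_category_def)
  have coX: "cocone C F M X \<iota>" using col by (simp add: is_colimit_def)
  have Ywh: "whdts Y"
    using T pullback_axioms[of T] by (auto simp: whdts_def makes_morphisms_def Y_def pullback_def)
  have khom: "\<kappa> i \<in> hom (F i) Y" if i: "i \<in> Ob C" for i
  proof -
    have i1: "\<iota> i \<in> hom (F i) (X\<lparr>Trans := T\<rparr>)" using T i by (auto simp: makes_morphisms_def)
    have Fi: "Trans (F i) \<subseteq> transitions_on (States (F i)) (Actions (F i))"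
      using dia i by (auto simp: diagram_def whdts_def)
    have "map_transition (\<kappa> i) t \<in> Trans Y" if t: "t \<in> Trans (F i)" for t
    proof -
      obtain \<alpha> us \<beta> where tt: "t = (\<alpha>, us, \<beta>)" by (cases t)
      have a: "\<alpha> \<in> States (F i)" "\<beta> \<in> States (F i)" "set us \<subseteq> Actions (F i)" "us \<noteq> []"
        using Fi t tt by (auto simp: transitions_on_def)
      have "map fst (map (snd (\<kappa> i)) us) = map (snd (\<iota> i)) us"
        using a by (auto simp: \<kappa>_def)
      moreover have "(fst (\<iota> i) \<alpha>, map (snd (\<iota> i)) us, fst (\<iota> i) \<beta>) \<in> T"
        using i1 t tt by (force simp: hom_def map_transition_def)
      ultimately have "map_transition (fst, fst) (map_transition (\<kappa> i) t) \<in> T"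
        using a tt by (simp add: map_transition_def \<kappa>_def del: map_map)
      moreover have "map_transition (\<kappa> i) t \<in> transitions_on (States X \<times> UNIV) (Actions X \<times> UNIV)"
        using a tt i1 by (fastforce simp: map_transition_def \<kappa>_def transitions_on_def hom_def)
      ultimately show ?thesis by (simp add: Y_def pullback_def)
    qed
    then show ?thesis using i1 by (auto simp: hom_def Y_def \<kappa>_def)
  qed
  have "cocone C F M Y \<kappa>"
    unfolding cocone_def
  proof (intro conjI ballI)
    fix e assume e: "e \<in> Ar C"
    have M: "M e \<in> hom (F (src C e)) (F (tgt C e))" using dia e by (auto simp: diagram_def)
    have i1: "\<iota> (src C e) \<in> hom (F (src C e)) X" using coX cat[OF e] by (auto simp: cocone_def)
    have "comp_mor (F (src C e)) (\<iota> (tgt C e)) (M e) = \<iota> (src C e)"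
      using coX e by (auto simp: cocone_def)
    then show "comp_mor (F (src C e)) (\<kappa> (tgt C e)) (M e) = \<kappa> (src C e)"
      unfolding comp_mor_eq_iff[OF i1] comp_mor_eq_iff[OF khom[OF cat(1)[OF e]]]
      using M P[OF e] Q[OF e] by (auto simp: \<kappa>_def hom_def PiE_def Pi_def)
  qed (use Ywh khom in auto)
  then have "\<exists>!g. g \<in> hom X Y \<and> (\<forall>i \<in> Ob C. comp_mor (F i) g (\<iota> i) = \<kappa> i)"
    using col by (simp add: is_colimit_def universal_wrt_def)
  moreover have "(\<forall>i \<in> Ob C. comp_mor (F i) g (\<iota> i) = \<kappa> i) \<longleftrightarrow>
      (\<forall>i \<in> Ob C. (\<forall>s \<in> States (F i). fst g (fst (\<iota> i) s) = (fst (\<iota> i) s, P i s)) \<and>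
        (\<forall>u \<in> Actions (F i). snd g (snd (\<iota> i) u) = (snd (\<iota> i) u, Q i u)))" for g
  proof (rule ball_cong[OF refl])
    fix i assume i: "i \<in> Ob C"
    show "(comp_mor (F i) g (\<iota> i) = \<kappa> i) \<longleftrightarrow>
       (\<forall>s \<in> States (F i). fst g (fst (\<iota> i) s) = (fst (\<iota> i) s, P i s)) \<and>
        (\<forall>u \<in> Actions (F i). snd g (snd (\<iota> i) u) = (snd (\<iota> i) u, Q i u))"
      unfolding comp_mor_eq_iff[OF khom[OF i]] by (simp add: \<kappa>_def)
  qed
  ultimately show ?thesis unfolding Y_def by simp
qed

lemma makes_morphisms_transitions_on:
  assumes "diagram C F M" "cocone C F M X \<iota>"
  shows "makes_morphisms C F X \<iota> (transitions_on (States X) (Actions X))"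
proof -
  have "multiset_axiom (transitions_on (States X) (Actions X))"
    "coherence_axiom (transitions_on (States X) (Actions X))"
    using pullback_axioms[of UNIV "States X" "Actions X" "(id, id)"]
    by (simp_all add: multiset_axiom_def coherence_axiom_def pullback_def)
  then have "whdts (X\<lparr>Trans := transitions_on (States X) (Actions X)\<rparr>)"
    by (auto simp: whdts_def)
  moreover have "\<iota> i \<in> hom (F i) (X\<lparr>Trans := transitions_on (States X) (Actions X)\<rparr>)"
    if "i \<in> Ob C" for i
  proof -
    have "\<iota> i \<in> hom (F i) X" "Trans X \<subseteq> transitions_on (States X) (Actions X)"
      using assms(2) that by (auto simp: cocone_def whdts_def)
    then show ?thesis by (auto simp: hom_def)
  qed
  ultimately show ?thesis by (simp add: makes_morphisms_def)
qed

lemma colimit_surj: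
  fixes X :: "('t, 'm, 'a) wts"
  assumes dia: "diagram C F M" and col: "is_colimit C F M X \<iota>"
  shows "States X = (\<Union>i \<in> Ob C. fst (\<iota> i) ` States (F i))"
    and "Actions X = (\<Union>i \<in> Ob C. snd (\<iota> i) ` Actions (F i))"
proof -
  let ?T = "transitions_on (States X) (Actions X)"
  let ?S = "\<Union>i \<in> Ob C. fst (\<iota> i) ` States (F i)"
  let ?L = "\<Union>i \<in> Ob C. snd (\<iota> i) ` Actions (F i)"
  let ?Y = "\<lparr>States = States X \<times> (UNIV :: bool set), Actions = Actions X \<times> (UNIV :: bool set),
        Label = Label X \<circ> fst,
        Trans = pullback (States X \<times> UNIV) (Actions X \<times> UNIV) (fst, fst) ?T\<rparr>"
  have coX: "cocone C F M X \<iota>" using col by (simp add: is_colimit_def)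
  have ih: "\<iota> i \<in> hom (F i) X" if "i \<in> Ob C" for i using coX that by (auto simp: cocone_def)
  define g where "g A B = (\<lambda>s \<in> States X. (s, s \<in> A), \<lambda>u \<in> Actions X. (u, u \<in> B))"
    for A :: "'t set" and B :: "'m set"
  have ghom: "g A B \<in> hom X ?Y" for A B
  proof -
    have sub: "Trans X \<subseteq> ?T" using coX by (auto simp: cocone_def whdts_def)
    have "map_transition (g A B) t \<in> Trans ?Y" if t: "t \<in> Trans X" for t
    proof -
      obtain \<alpha> us \<beta> where tt: "t = (\<alpha>, us, \<beta>)" by (cases t)
      have a: "\<alpha> \<in> States X" "\<beta> \<in> States X" "set us \<subseteq> Actions X" "us \<noteq> []"
        using sub t tt by (auto simp: transitions_on_def)
      then show ?thesis
        using tt by (auto simp: g_def map_transition_def pullback_def transitions_on_def)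
    qed
    then show ?thesis by (auto simp: hom_def g_def)
  qed
  have unique: "g A B = g A' B'" if AB: "?S \<subseteq> A" "?L \<subseteq> B" "?S \<subseteq> A'" "?L \<subseteq> B'" for A B A' B'
  proof -
    have ok: "\<forall>i \<in> Ob C. (\<forall>s \<in> States (F i). fst (g A B) (fst (\<iota> i) s) = (fst (\<iota> i) s, True)) \<and>
        (\<forall>u \<in> Actions (F i). snd (g A B) (snd (\<iota> i) u) = (snd (\<iota> i) u, True))"
      if "?S \<subseteq> A" "?L \<subseteq> B" for A B
      using that ih by (fastforce simp: g_def hom_def PiE_def Pi_def)
    have ex1_eq: "x = y" if "\<exists>!g. R g" "R x" "R y" for R and x y :: "('t, 'm, 't \<times> bool, 'm \<times> bool) mor"
      using that by blast
    show ?thesis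
      by (rule ex1_eq[OF colimit_lift[OF dia col makes_morphisms_transitions_on[OF dia coX],
          of "\<lambda>_ _. True" "\<lambda>_ _. True"] conjI[OF ghom ok] conjI[OF ghom ok]])
        (use AB in simp_all)
  qed
  have "g ?S ?L = g UNIV UNIV" using unique by blast
  then have eq: "fst (g ?S ?L) s = fst (g UNIV UNIV) s" "snd (g ?S ?L) u = snd (g UNIV UNIV) u" for s u
    by simp_all
  have "s \<in> ?S" if "s \<in> States X" for s using eq(1)[of s] that by (simp add: g_def)
  moreover have "u \<in> ?L" if "u \<in> Actions X" for u using eq(2)[of u] that by (simp add: g_def)
  moreover have "?S \<subseteq> States X" "?L \<subseteq> Actions X"
    using ih by (auto simp: hom_def PiE_def Pi_def)
  ultimately show "States X = ?S" "Actions X = ?L" by blast+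
qed

theorem colimit_universal:
  fixes F :: "'i \<Rightarrow> ('s, 'l, 'a) wts" and X :: "('t, 'm, 'a) wts"
  assumes dia: "diagram C F M" and col: "is_colimit C F M X \<iota>"
  shows "universal_wrt TYPE('u) TYPE('v) C F M X \<iota>"
  unfolding universal_wrt_def
proof (intro allI impI)
  fix Y :: "('u, 'v, 'a) wts" and \<kappa>
  assume coY: "cocone C F M Y \<kappa>"
  have coX: "cocone C F M X \<iota>" using col by (simp add: is_colimit_def)
  have ih: "\<iota> i \<in> hom (F i) X" and kh: "\<kappa> i \<in> hom (F i) Y" if "i \<in> Ob C" for i
    using coX coY that by (auto simp: cocone_def)
  have cat: "src C e \<in> Ob C" "tgt C e \<in> Ob C" if "e \<in> Ar C" for e
    using dia that by (auto simp: diagram_def small_category_def)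
  have kc: "\<forall>s \<in> States (F (src C e)). fst (\<kappa> (tgt C e)) (fst (M e) s) = fst (\<kappa> (src C e)) s"
    "\<forall>u \<in> Actions (F (src C e)). snd (\<kappa> (tgt C e)) (snd (M e) u) = snd (\<kappa> (src C e)) u"
    if e: "e \<in> Ar C" for e
    using coY e comp_mor_eq_iff[OF kh[OF cat(1)[OF e]]] unfolding cocone_def by blast+
  note lift0 = colimit_lift[OF dia col makes_morphisms_transitions_on[OF dia coX]]
  have lift1: "\<exists>g. \<forall>k \<in> Ob C. (\<forall>s \<in> States (F k). fst g (fst (\<iota> k) s) = (fst (\<iota> k) s, P k s)) \<and>
      (\<forall>u \<in> Actions (F k). snd g (snd (\<iota> k) u) = (snd (\<iota> k) u, Q k u))"
    if "\<And>e s. e \<in> Ar C \<Longrightarrow> s \<in> States (F (src C e)) \<Longrightarrow> P (tgt C e) (fst (M e) s) = P (src C e) s"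
      and "\<And>e u. e \<in> Ar C \<Longrightarrow> u \<in> Actions (F (src C e)) \<Longrightarrow> Q (tgt C e) (snd (M e) u) = Q (src C e) u"
    for P :: "'i \<Rightarrow> 's \<Rightarrow> bool" and Q :: "'i \<Rightarrow> 'l \<Rightarrow> bool"
    using ex1_implies_ex[OF lift0[of P Q, OF that]] by blast
  have ker0: "fst (\<kappa> j) y = fst (\<kappa> i) x"
    if "i \<in> Ob C" "j \<in> Ob C" "x \<in> States (F i)" "y \<in> States (F j)" "fst (\<iota> i) x = fst (\<iota> j) y"
    for i j x y
  proof -
    have "\<exists>g :: ('t, 'm, 't \<times> bool, 'm \<times> bool) mor. \<forall>k \<in> Ob C. \<forall>s \<in> States (F k). fst g (fst (\<iota> k) s) = (fst (\<iota> k) s, fst (\<kappa> k) s = fst (\<kappa> i) x)"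
      by (rule ex_forward[OF lift1[of "\<lambda>k s. fst (\<kappa> k) s = fst (\<kappa> i) x" "\<lambda>_ _. True"]])
        (simp_all add: kc)
    then obtain g :: "('t, 'm, 't \<times> bool, 'm \<times> bool) mor" where g:
      "\<forall>k \<in> Ob C. \<forall>s \<in> States (F k). fst g (fst (\<iota> k) s) = (fst (\<iota> k) s, fst (\<kappa> k) s = fst (\<kappa> i) x)" ..
    have "fst g (fst (\<iota> i) x) = (fst (\<iota> i) x, True)" using g that(1,3) by simp
    moreover have "fst g (fst (\<iota> j) y) = (fst (\<iota> j) y, fst (\<kappa> j) y = fst (\<kappa> i) x)"
      using g that(2,4) by blast
    ultimately show ?thesis using that(5) by simp
  qed
  have ker1: "snd (\<kappa> j) y = snd (\<kappa> i) x"
    if "i \<in> Ob C" "j \<in> Ob C" "x \<in> Actions (F i)" "y \<in> Actions (F j)" "snd (\<iota> i) x = snd (\<iota> j) y"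
    for i j x y
  proof -
    have "\<exists>g :: ('t, 'm, 't \<times> bool, 'm \<times> bool) mor. \<forall>k \<in> Ob C. \<forall>s \<in> Actions (F k). snd g (snd (\<iota> k) s) = (snd (\<iota> k) s, snd (\<kappa> k) s = snd (\<kappa> i) x)"
      by (rule ex_forward[OF lift1[of "\<lambda>_ _. True" "\<lambda>k s. snd (\<kappa> k) s = snd (\<kappa> i) x"]])
        (simp_all add: kc)
    then obtain g :: "('t, 'm, 't \<times> bool, 'm \<times> bool) mor" where g:
      "\<forall>k \<in> Ob C. \<forall>s \<in> Actions (F k). snd g (snd (\<iota> k) s) = (snd (\<iota> k) s, snd (\<kappa> k) s = snd (\<kappa> i) x)" ..
    have "snd g (snd (\<iota> i) x) = (snd (\<iota> i) x, True)" using g that(1,3) by simp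
    moreover have "snd g (snd (\<iota> j) y) = (snd (\<iota> j) y, snd (\<kappa> j) y = snd (\<kappa> i) x)"
      using g that(2,4) by blast
    ultimately show ?thesis using that(5) by simp
  qed
  note sur = colimit_surj[OF dia col]
  define g where "g = (\<lambda>s \<in> States X. SOME v. \<exists>i \<in> Ob C. \<exists>x \<in> States (F i). s = fst (\<iota> i) x \<and> v = fst (\<kappa> i) x,
    \<lambda>u \<in> Actions X. SOME v. \<exists>i \<in> Ob C. \<exists>x \<in> Actions (F i). u = snd (\<iota> i) x \<and> v = snd (\<kappa> i) x)"
  have g0: "fst g (fst (\<iota> i) x) = fst (\<kappa> i) x" if i: "i \<in> Ob C" "x \<in> States (F i)" for i x
  proof -
    have "fst (\<iota> i) x \<in> States X" using sur i by auto
    moreover have "(SOME v. \<exists>j \<in> Ob C. \<exists>y \<in> States (F j). fst (\<iota> i) x = fst (\<iota> j) y \<and> v = fst (\<kappa> j) y)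
        = fst (\<kappa> i) x"
      using i ker0 by (intro some_equality) blast+
    ultimately show ?thesis by (simp add: g_def)
  qed
  have g1: "snd g (snd (\<iota> i) x) = snd (\<kappa> i) x" if i: "i \<in> Ob C" "x \<in> Actions (F i)" for i x
  proof -
    have "snd (\<iota> i) x \<in> Actions X" using sur i by auto
    moreover have "(SOME v. \<exists>j \<in> Ob C. \<exists>y \<in> Actions (F j). snd (\<iota> i) x = snd (\<iota> j) y \<and> v = snd (\<kappa> j) y)
        = snd (\<kappa> i) x"
      using i ker1 by (intro some_equality) blast+
    ultimately show ?thesis by (simp add: g_def)
  qed
  define T where "T = pullback (States X) (Actions X) g (Trans Y)"
  have mT: "makes_morphisms C F X \<iota> T"
    unfolding makes_morphisms_def
  proof (intro conjI ballI)
    show "whdts (X\<lparr>Trans := T\<rparr>)"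
      using pullback_axioms[of "Trans Y" "States X" "Actions X" g] coY
      by (auto simp: whdts_def cocone_def T_def pullback_def)
    fix i assume i: "i \<in> Ob C"
    have "map_transition (\<iota> i) t \<in> T" if t: "t \<in> Trans (F i)" for t
    proof -
      obtain \<alpha> us \<beta> where tt: "t = (\<alpha>, us, \<beta>)" by (cases t)
      have a: "\<alpha> \<in> States (F i)" "\<beta> \<in> States (F i)" "set us \<subseteq> Actions (F i)" "us \<noteq> []"
        using dia i t tt by (auto simp: diagram_def whdts_def transitions_on_def)
      have "map (snd g) (map (snd (\<iota> i)) us) = map (snd (\<kappa> i)) us" using a g1[OF i] by auto
      moreover have "map_transition (\<kappa> i) t \<in> Trans Y" using kh[OF i] t by (auto simp: hom_def)
      ultimately have "map_transition g (map_transition (\<iota> i) t) \<in> Trans Y"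
        using a g0[OF i] tt by (simp add: map_transition_def del: map_map)
      moreover have "map_transition (\<iota> i) t \<in> Trans X" using ih[OF i] t by (auto simp: hom_def)
      then have "map_transition (\<iota> i) t \<in> transitions_on (States X) (Actions X)"
        using coX by (auto simp: cocone_def whdts_def)
      ultimately show ?thesis by (simp add: T_def pullback_def)
    qed
    then show "\<iota> i \<in> hom (F i) (X\<lparr>Trans := T\<rparr>)" using ih[OF i] by (auto simp: hom_def)
  qed
  obtain h where h: "h \<in> hom X \<lparr>States = States X \<times> (UNIV :: bool set),
        Actions = Actions X \<times> (UNIV :: bool set), Label = Label X \<circ> fst,
        Trans = pullback (States X \<times> UNIV) (Actions X \<times> UNIV) (fst, fst) T\<rparr>"
    and hi: "\<forall>i \<in> Ob C. (\<forall>s \<in> States (F i). fst h (fst (\<iota> i) s) = (fst (\<iota> i) s, True)) \<and>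
        (\<forall>u \<in> Actions (F i). snd h (snd (\<iota> i) u) = (snd (\<iota> i) u, True))"
    using colimit_lift[OF dia col mT, of "\<lambda>_ _. True" "\<lambda>_ _. True"] by auto
  have h0: "fst h s = (s, True)" if "s \<in> States X" for s using sur(1) that hi by auto
  have h1: "snd h u = (u, True)" if "u \<in> Actions X" for u using sur(2) that hi by auto
  have sub: "map_transition g t \<in> Trans Y" if t: "t \<in> Trans X" for t
  proof -
    obtain \<alpha> us \<beta> where tt: "t = (\<alpha>, us, \<beta>)" by (cases t)
    have a: "\<alpha> \<in> States X" "\<beta> \<in> States X" "set us \<subseteq> Actions X" "us \<noteq> []"
      using coX t tt by (auto simp: cocone_def whdts_def transitions_on_def)
    have "map_transition (fst, fst) (map_transition h t) \<in> T"
      using h t by (auto simp: hom_def pullback_def)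
    moreover have "map fst (map (snd h) us) = us" unfolding map_map using a h1 by (intro map_idI) auto
    ultimately have "t \<in> T" using a h0 tt by (simp add: map_transition_def del: map_map)
    then show ?thesis by (simp add: T_def pullback_def)
  qed
  have ghom: "g \<in> hom X Y"
  proof -
    have "fst g s \<in> States Y" if s: "s \<in> States X" for s
    proof -
      obtain i x where "i \<in> Ob C" "x \<in> States (F i)" "s = fst (\<iota> i) x"
        using s[unfolded sur(1)] by blast
      then show ?thesis using g0 kh[of i] by (auto simp: hom_def)
    qed
    moreover have "snd g u \<in> Actions Y \<and> Label Y (snd g u) = Label X u" if u: "u \<in> Actions X" for u
    proof -
      obtain i x where "i \<in> Ob C" "x \<in> Actions (F i)" "u = snd (\<iota> i) x"
        using u[unfolded sur(2)] by blast
      then show ?thesis using g1 kh[of i] ih[of i] by (auto simp: hom_def)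
    qed
    moreover have "fst g \<in> extensional (States X)" "snd g \<in> extensional (Actions X)"
      by (simp_all add: g_def)
    ultimately show ?thesis using sub by (auto simp: hom_def PiE_def)
  qed
  show "\<exists>!g. g \<in> hom X Y \<and> (\<forall>i \<in> Ob C. comp_mor (F i) g (\<iota> i) = \<kappa> i)"
  proof (rule ex1I[of _ g])
    show "g \<in> hom X Y \<and> (\<forall>i \<in> Ob C. comp_mor (F i) g (\<iota> i) = \<kappa> i)"
      using ghom g0 g1 comp_mor_eq_iff[OF kh] by blast
    fix k assume k: "k \<in> hom X Y \<and> (\<forall>i \<in> Ob C. comp_mor (F i) k (\<iota> i) = \<kappa> i)"
    have k0: "\<forall>i \<in> Ob C. \<forall>x \<in> States (F i). fst k (fst (\<iota> i) x) = fst (\<kappa> i) x"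
      and k1: "\<forall>i \<in> Ob C. \<forall>x \<in> Actions (F i). snd k (snd (\<iota> i) x) = snd (\<kappa> i) x"
      using k comp_mor_eq_iff[OF kh] by blast+
    have "fst k = fst g"
    proof (rule extensionalityI[of _ "States X"])
      show "fst k s = fst g s" if "s \<in> States X" for s using that[unfolded sur(1)] k0 g0 by auto
    qed (use k ghom in \<open>auto simp: hom_def PiE_def\<close>)
    moreover have "snd k = snd g"
    proof (rule extensionalityI[of _ "Actions X"])
      show "snd k u = snd g u" if "u \<in> Actions X" for u using that[unfolded sur(2)] k1 g1 by auto
    qed (use k ghom in \<open>auto simp: hom_def PiE_def\<close>)
    ultimately show "k = g" by (simp add: prod_eq_iff)
  qed
qed

end

theory Submission
  imports Defs
begin

text \<open>
  Write \<open>U\<close> for the union of the images of the sets of transitions of the \<open>F i\<close>. Everything rests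
  on lifting a transition of \<open>U\<close> to a transition of a single \<open>F i\<close>, dividing it there, and mapping
  the result back. In this way \<open>U\<close> always satisfies the Multiset axiom, and each of its transitions
  has at least one intermediate state at each position. What \<open>U\<close> can lack is uniqueness of
  intermediate states, since different transitions of the \<open>F i\<close> may have the same image, and
  the Coherence axiom, since the five transitions in its hypothesis may come from different \<open>F i\<close>.

  The second defect cannot occur without the first. If intermediate states are unique in \<open>U\<close>, the
  states \<open>\<nu>\<^sub>1\<close> and \<open>\<nu>\<^sub>2\<close> of the Coherence axiom must be the images of the intermediate states of a
  lift of the long transition, so that the Coherence axiom can be applied inside one \<open>F i\<close>
  (\<open>union_trans_coherence\<close>). Hence the second condition implies the third. Call a set of
  transitions on the states and actions of \<open>X\<close> admissible if it satisfies these two axioms and makes the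
  \<open>\<iota> i\<close> morphisms (\<open>makes_morphisms\<close>). Then \<open>U\<close> is itself admissible; as the set of transitions of a
  colimit is the least admissible one (\<open>colimit_final_structure\<close>), it equals \<open>U\<close>, and the first
  condition follows. Conversely, uniqueness of intermediate states passes from the transitions of
  \<open>X\<close> to the subset \<open>U\<close>, and existence in \<open>U\<close> always holds
  (\<open>union_trans_unique_intermediate_state\<close>).
\<close>

lemma union_transE:
  assumes "(\<alpha>, us, \<beta>) \<in> union_trans C F \<iota>"
  obtains i a ws b where "i \<in> Ob C" "(a, ws, b) \<in> Trans (F i)"
    "\<alpha> = fst (\<iota> i) a" "us = map (snd (\<iota> i)) ws" "\<beta> = fst (\<iota> i) b"
  using assms by (force simp: union_trans_def map_transition_def)

lemma union_transI:
  assumes "i \<in> Ob C" "(a, ws, b) \<in> Trans (F i)"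
  shows "(fst (\<iota> i) a, map (snd (\<iota> i)) ws, fst (\<iota> i) b) \<in> union_trans C F \<iota>"
  using assms by (force simp: union_trans_def map_transition_def)

lemma unique_intermediate_stateD:
  assumes "unique_intermediate_state T" "(\<alpha>, us, \<beta>) \<in> T" "1 \<le> p" "p < length us"
  shows "\<exists>!\<nu>. (\<alpha>, take p us, \<nu>) \<in> T \<and> (\<nu>, drop p us, \<beta>) \<in> T"
  using assms(1)[unfolded unique_intermediate_state_def, rule_format, of us p \<alpha> \<beta>] assms(2-)
  by simp

text \<open>
  A permutation of the actions of a transition commutes with relabelling them, so it can be
  performed in the \<open>F i\<close> from which the transition comes.
\<close>

lemma union_trans_multiset:
  assumes "\<forall>i \<in> Ob C. multiset_axiom (Trans (F i))"
  shows "multiset_axiom (union_trans C F \<iota>)"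
  unfolding multiset_axiom_def
proof (intro allI impI)
  fix \<alpha> us \<beta> \<sigma>
  assume len: "2 \<le> length us" and perm: "\<sigma> permutes {..<length us}"
    and "(\<alpha>, us, \<beta>) \<in> union_trans C F \<iota>"
  then obtain i a ws b where i: "i \<in> Ob C" "(a, ws, b) \<in> Trans (F i)"
    and eq: "\<alpha> = fst (\<iota> i) a" "us = map (snd (\<iota> i)) ws" "\<beta> = fst (\<iota> i) b"
    by (auto elim: union_transE)
  have "(a, permute_list \<sigma> ws, b) \<in> Trans (F i)"
    using assms i len perm eq by (auto simp: multiset_axiom_def)
  from union_transI[where F = F and \<iota> = \<iota>, OF i(1) this]
  show "(\<alpha>, permute_list \<sigma> us, \<beta>) \<in> union_trans C F \<iota>"
    using eq perm by (simp add: permute_list_map)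
qed

text \<open>
  An intermediate state of a transition of some \<open>F i\<close> is mapped to an intermediate state of its
  image; only uniqueness can get lost. It is inherited from any larger set of transitions, and
  \<open>T\<close> will be the set of transitions of the colimit.
\<close>

lemma union_trans_unique_intermediate_state:
  assumes F: "\<forall>i \<in> Ob C. unique_intermediate_state (Trans (F i))"
    and sub: "union_trans C F \<iota> \<subseteq> T" and T: "unique_intermediate_state T"
  shows "unique_intermediate_state (union_trans C F \<iota>)"
  unfolding unique_intermediate_state_def
proof (intro allI impI)
  fix \<alpha> us \<beta> p
  assume p: "1 \<le> p" "p < length us" and t: "(\<alpha>, us, \<beta>) \<in> union_trans C F \<iota>"
  let ?P = "\<lambda>\<nu>. (\<alpha>, take p us, \<nu>) \<in> union_trans C F \<iota> \<and> (\<nu>, drop p us, \<beta>) \<in> union_trans C F \<iota>"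
  obtain i a ws b where i: "i \<in> Ob C" "(a, ws, b) \<in> Trans (F i)"
    and eq: "\<alpha> = fst (\<iota> i) a" "us = map (snd (\<iota> i)) ws" "\<beta> = fst (\<iota> i) b"
    using t by (rule union_transE)
  obtain \<nu> where "(a, take p ws, \<nu>) \<in> Trans (F i)" "(\<nu>, drop p ws, b) \<in> Trans (F i)"
    using unique_intermediate_stateD[of "Trans (F i)" a ws b p] F i p eq by auto
  then have "?P (fst (\<iota> i) \<nu>)"
    using i(1) eq by (auto simp: take_map drop_map intro!: union_transI)
  moreover have "\<nu>\<^sub>1 = \<nu>\<^sub>2" if "?P \<nu>\<^sub>1" "?P \<nu>\<^sub>2" for \<nu>\<^sub>1 \<nu>\<^sub>2
    using unique_intermediate_stateD[OF T, of \<alpha> us \<beta> p] t p that sub by blast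
  ultimately show "\<exists>!\<nu>. ?P \<nu>" by blast
qed

text \<open>
  The five transitions in the Coherence axiom may come from different objects. Choose a lift of
  the long one to some \<open>F i\<close> and divide this lift in \<open>F i\<close>: by uniqueness in the union, the images
  of its intermediate states are the given \<open>\<nu>\<^sub>1\<close> and \<open>\<nu>\<^sub>2\<close>, so the Coherence axiom of this one \<open>F i\<close>
  provides the transition from \<open>\<nu>\<^sub>1\<close> to \<open>\<nu>\<^sub>2\<close>.
\<close>

lemma union_trans_coherence:
  assumes F: "\<forall>i \<in> Ob C. unique_intermediate_state (Trans (F i))"
    and coh: "\<forall>i \<in> Ob C. coherence_axiom (Trans (F i))"
    and U: "unique_intermediate_state (union_trans C F \<iota>)"
  shows "coherence_axiom (union_trans C F \<iota>)"
  unfolding coherence_axiom_def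
proof (intro allI impI)
  fix \<alpha> us \<beta> \<nu>\<^sub>1 \<nu>\<^sub>2 p q
  assume len: "3 \<le> length us" "1 \<le> p" "1 \<le> q" "p + q < length us"
    and t: "(\<alpha>, us, \<beta>) \<in> union_trans C F \<iota>"
    and \<nu>\<^sub>1: "(\<alpha>, take p us, \<nu>\<^sub>1) \<in> union_trans C F \<iota>" "(\<nu>\<^sub>1, drop p us, \<beta>) \<in> union_trans C F \<iota>"
    and \<nu>\<^sub>2: "(\<alpha>, take (p + q) us, \<nu>\<^sub>2) \<in> union_trans C F \<iota>"
      "(\<nu>\<^sub>2, drop (p + q) us, \<beta>) \<in> union_trans C F \<iota>"
  obtain i a ws b where i: "i \<in> Ob C" "(a, ws, b) \<in> Trans (F i)"
    and eq: "\<alpha> = fst (\<iota> i) a" "us = map (snd (\<iota> i)) ws" "\<beta> = fst (\<iota> i) b"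
    using t by (rule union_transE)
  have lift: "\<exists>c. (a, take r ws, c) \<in> Trans (F i) \<and> (c, drop r ws, b) \<in> Trans (F i) \<and> \<nu> = fst (\<iota> i) c"
    if r: "1 \<le> r" "r < length us"
      and \<nu>: "(\<alpha>, take r us, \<nu>) \<in> union_trans C F \<iota>" "(\<nu>, drop r us, \<beta>) \<in> union_trans C F \<iota>" for r \<nu>
  proof -
    obtain c where c: "(a, take r ws, c) \<in> Trans (F i)" "(c, drop r ws, b) \<in> Trans (F i)"
      using unique_intermediate_stateD[of "Trans (F i)" a ws b r] F i r eq by auto
    have "(\<alpha>, take r us, fst (\<iota> i) c) \<in> union_trans C F \<iota>"
      "(fst (\<iota> i) c, drop r us, \<beta>) \<in> union_trans C F \<iota>"
      using i(1) c eq by (auto simp: take_map drop_map intro!: union_transI)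
    then have "\<nu> = fst (\<iota> i) c"
      using unique_intermediate_stateD[OF U t r] \<nu> by blast
    then show ?thesis using c by blast
  qed
  obtain c\<^sub>1 where c\<^sub>1: "(a, take p ws, c\<^sub>1) \<in> Trans (F i)" "(c\<^sub>1, drop p ws, b) \<in> Trans (F i)"
    "\<nu>\<^sub>1 = fst (\<iota> i) c\<^sub>1"
    using lift[of p \<nu>\<^sub>1] \<nu>\<^sub>1 len by auto
  obtain c\<^sub>2 where c\<^sub>2: "(a, take (p + q) ws, c\<^sub>2) \<in> Trans (F i)" "(c\<^sub>2, drop (p + q) ws, b) \<in> Trans (F i)"
    "\<nu>\<^sub>2 = fst (\<iota> i) c\<^sub>2"
    using lift[of "p + q" \<nu>\<^sub>2] \<nu>\<^sub>2 len by auto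
  have "coherence_axiom (Trans (F i))" using coh i(1) by blast
  from this[unfolded coherence_axiom_def, rule_format, of ws p q a b c\<^sub>1 c\<^sub>2]
  have "(c\<^sub>1, take q (drop p ws), c\<^sub>2) \<in> Trans (F i)"
    using i(2) c\<^sub>1(1,2) c\<^sub>2(1,2) len eq(2) by simp
  from union_transI[where F = F and \<iota> = \<iota>, OF i(1) this]
  show "(\<nu>\<^sub>1, take q (drop p us), \<nu>\<^sub>2) \<in> union_trans C F \<iota>"
    using eq(2) c\<^sub>1(3) c\<^sub>2(3) by (simp add: take_map drop_map)
qed

text \<open>
  If \<open>T'\<close> is admissible, the \<open>\<iota> i\<close> also form a cocone over \<open>X\<close> with \<open>T'\<close> as its set of transitions.
  The comparison morphism from \<open>X\<close> to this object is the identity on states and actions, because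
  the \<open>\<iota> i\<close> are jointly surjective; that it is a morphism means that the transitions of \<open>X\<close> belong
  to \<open>T'\<close>.
\<close>

lemma colimit_final_structure:
  fixes F :: "'i \<Rightarrow> ('s, 'l, 'a) wts" and X :: "('t, 'm, 'a) wts"
  assumes dia: "diagram C F M" and col: "is_colimit C F M X \<iota>"
  shows "is_final_structure C F X \<iota> (Trans X)"
  unfolding is_final_structure_def
proof (intro conjI allI impI)
  have coX: "cocone C F M X \<iota>" using col by (simp add: is_colimit_def)
  then show "makes_morphisms C F X \<iota> (Trans X)"
    by (simp add: cocone_def makes_morphisms_def)
  fix T' assume T': "makes_morphisms C F X \<iota> T'"
  let ?Y = "X\<lparr>Trans := T'\<rparr>"
  have ih: "\<iota> i \<in> hom (F i) ?Y" if "i \<in> Ob C" for i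
    using T' that by (simp add: makes_morphisms_def)
  have "cocone C F M ?Y \<iota>"
    using T' coX by (simp add: cocone_def makes_morphisms_def)
  then obtain g where g: "g \<in> hom X ?Y" and gi: "\<forall>i \<in> Ob C. comp_mor (F i) g (\<iota> i) = \<iota> i"
    using colimit_universal[OF dia col, where 'u = 't and 'v = 'm]
    unfolding universal_wrt_def by blast
  have g0: "fst g s = s" if "s \<in> States X" for s
    using that[unfolded colimit_surj(1)[OF dia col]] gi comp_mor_eq_iff[OF ih] by blast
  have g1: "snd g u = u" if "u \<in> Actions X" for u
    using that[unfolded colimit_surj(2)[OF dia col]] gi comp_mor_eq_iff[OF ih] by blast
  show "Trans X \<subseteq> T'"
  proof
    fix t assume t: "t \<in> Trans X"
    obtain \<alpha> us \<beta> where tt: "t = (\<alpha>, us, \<beta>)" by (cases t)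
    have "\<alpha> \<in> States X" "\<beta> \<in> States X" "set us \<subseteq> Actions X"
      using coX t tt by (auto simp: cocone_def whdts_def transitions_on_def)
    then have "map_transition g t = t"
      using tt g0 g1 by (auto simp: map_transition_def intro!: map_idI)
    moreover have "map_transition g t \<in> T'" using g t by (auto simp: hom_def)
    ultimately show "t \<in> T'" by simp
  qed
qed

lemma union_trans_subset:
  assumes "makes_morphisms C F X \<iota> T"
  shows "union_trans C F \<iota> \<subseteq> T"
  using assms by (fastforce simp: makes_morphisms_def hom_def union_trans_def)

text \<open>
  The union is contained in every admissible set of transitions, so it is the least one as soon as
  it is admissible itself, which depends on the two axioms only.
\<close>

lemma union_trans_final_structure:
  assumes X: "is_final_structure C F X \<iota> T"
    and "multiset_axiom (union_trans C F \<iota>)" "coherence_axiom (union_trans C F \<iota>)"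
  shows "is_final_structure C F X \<iota> (union_trans C F \<iota>)" "T = union_trans C F \<iota>"
proof -
  have T: "makes_morphisms C F X \<iota> T" using X by (simp add: is_final_structure_def)
  note sub = union_trans_subset[OF T]
  have "whdts (X\<lparr>Trans := union_trans C F \<iota>\<rparr>)"
    using T sub assms(2,3) by (auto simp: makes_morphisms_def whdts_def)
  moreover have "\<iota> i \<in> hom (F i) (X\<lparr>Trans := union_trans C F \<iota>\<rparr>)" if "i \<in> Ob C" for i
    using T that by (auto simp: makes_morphisms_def hom_def union_trans_def)
  ultimately have U: "makes_morphisms C F X \<iota> (union_trans C F \<iota>)"
    by (simp add: makes_morphisms_def)
  then show "T = union_trans C F \<iota>" using X sub by (auto simp: is_final_structure_def)
  show "is_final_structure C F X \<iota> (union_trans C F \<iota>)"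
    using U by (simp add: is_final_structure_def union_trans_subset[of C F X \<iota>])
qed

theorem theorem4p7:
  fixes C :: "('i, 'e) category"
    and F :: "'i \<Rightarrow> ('s, 'l, 'a) wts"
    and M :: "'e \<Rightarrow> ('s, 'l, 's, 'l) mor"
    and X :: "('t, 'm, 'a) wts"
    and \<iota> :: "'i \<Rightarrow> ('s, 'l, 't, 'm) mor"
  assumes "diagram C F M"
    and "is_colimit C F M X \<iota>"
    and "\<forall>i \<in> Ob C. unique_intermediate_state (Trans (F i))"
  shows "(unique_intermediate_state (Trans X) \<longleftrightarrow>
            unique_intermediate_state (union_trans C F \<iota>)) \<and>
         (unique_intermediate_state (union_trans C F \<iota>) \<longleftrightarrow>
            multiset_axiom (union_trans C F \<iota>) \<and> coherence_axiom (union_trans C F \<iota>) \<and>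
            unique_intermediate_state (union_trans C F \<iota>)) \<and>
         (unique_intermediate_state (Trans X) \<or>
          unique_intermediate_state (union_trans C F \<iota>) \<or>
          (multiset_axiom (union_trans C F \<iota>) \<and> coherence_axiom (union_trans C F \<iota>) \<and>
            unique_intermediate_state (union_trans C F \<iota>)) \<longrightarrow>
          is_final_structure C F X \<iota> (union_trans C F \<iota>) \<and> Trans X = union_trans C F \<iota>)"
proof -
  let ?U = "union_trans C F \<iota>"
  have whdts: "\<forall>i \<in> Ob C. whdts (F i)" using assms(1) by (simp add: diagram_def)
  have final: "is_final_structure C F X \<iota> (Trans X)"
    by (rule colimit_final_structure[OF assms(1,2)])
  then have sub: "?U \<subseteq> Trans X"
    by (intro union_trans_subset[of C F X \<iota>]) (simp add: is_final_structure_def)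
  have mult: "multiset_axiom ?U"
    by (rule union_trans_multiset) (use whdts in \<open>simp add: whdts_def\<close>)
  have coh: "coherence_axiom ?U" if "unique_intermediate_state ?U"
    using union_trans_coherence[OF assms(3) _ that] whdts by (auto simp: whdts_def)
  have U: "unique_intermediate_state ?U" if "unique_intermediate_state (Trans X)"
    by (rule union_trans_unique_intermediate_state[OF assms(3) sub that])
  have "is_final_structure C F X \<iota> ?U \<and> Trans X = ?U" if "unique_intermediate_state ?U"
    using union_trans_final_structure[OF final mult coh[OF that]] by simp
  then show ?thesis using mult coh U by metis
qed

end
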